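(* Let $K\subseteq\mathbb{R}^n$ be a proper convex cone and let $f\in\mathbb{R}[x_1,\dots,x_n]$ be a nonzero form (homogeneous polynomial) of degree $d\ge 2$. For $a\in\mathbb{R}^n$ let $H_f(a)$ denote the Hessian matrix of $f$ at $a$. (a) If $f$ is a strictly $K$-CLC form, then $H_f(a)$ is nonsingular and has exactly one positive eigenvalue for all $a\in K$. Also, the quadratic form $x^{t}H_f(a)x$ is negative definite on $(H_f(a)b)^{\perp}$ for every $a,b\in K$ such that $H_f(a)b\neq 0$. (b) If $f$ is a $K$-CLC form, then $H_f(a)$ has exactly one positive eigenvalue for all $a\in\operatorname{int}K$. Also, the quadratic form $x^{t}H_f(a)x$ is negative semidefinite on $(H_f(a)b)^{\perp}$ for every $a\in\operatorname{int}K$ and $b\in K$ such that $H_f(a)b\neq 0$.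
   Context: A proper convex cone $K\subseteq\mathbb{R}^n$ is a nonempty convex set with $cK\subseteq K$ for all $c\ge0$ that is closed, pointed ($K\cap(-K)=\{0\}$) and has nonempty interior $\operatorname{int}K$. For $a\in\mathbb{R}^n$, $D_af=\sum_i a_i\,\partial f/\partial x_i$. A polynomial $f$ is log-concave (resp. strictly log-concave) at a point $a$ if $f(a)>0$ and the Hessian of $\log f$ at $a$ is negative semidefinite (resp. negative definite). By convention the zero polynomial is log-concave (but not strictly log-concave) at all points. A polynomial $f$ of degree $d$ is $K$-completely log-concave ($K$-CLC) if for any choice of $a_1,\dots,a_m\in K$ with $m\le d$, the polynomial $D_{a_1}\cdots D_{a_m}f$ is log-concave at every point of $\operatorname{int}K$. A polynomial $f$ of degree $d$ is strictly $K$-CLC if for any choice of $a_1,\dots,a_m\in K$ with $m\le d$, the polynomial $D_{a_1}\cdots D_{a_m}f$ is strictly log-concave at all points of $K$. Here $w^\perp$ is the orthogonal complement of $w$ in $\mathbb{R}^n$ for the standard inner product. *)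

theory Defs
  imports
    "HOL-Analysis.Analysis"
    "HOL-Library.Poly_Mapping"
    "HOL-Computational_Algebra.Computational_Algebra"
begin

subsection \<open>Polynomials in variables indexed by a finite type\<close>

text \<open>A monomial maps each variable to its exponent; a polynomial maps each monomial to its
  coefficient.\<close>

type_synonym 'n mpoly = "('n \<Rightarrow>\<^sub>0 nat) \<Rightarrow>\<^sub>0 real"

definition mon_degree :: "('n::finite \<Rightarrow>\<^sub>0 nat) \<Rightarrow> nat" where
  "mon_degree m = (\<Sum>i\<in>UNIV. Poly_Mapping.lookup m i)"

definition total_degree :: "'n::finite mpoly \<Rightarrow> nat" where
  "total_degree f = Max (insert 0 (mon_degree ` Poly_Mapping.keys f))"

definition homogeneous :: "nat \<Rightarrow> 'n::finite mpoly \<Rightarrow> bool" where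
  "homogeneous d f \<longleftrightarrow> (\<forall>m\<in>Poly_Mapping.keys f. mon_degree m = d)"

definition poly_eval :: "'n::finite mpoly \<Rightarrow> real ^ 'n \<Rightarrow> real" where
  "poly_eval f x =
     (\<Sum>m\<in>Poly_Mapping.keys f.
        Poly_Mapping.lookup f m * (\<Prod>i\<in>UNIV. (x $ i) ^ Poly_Mapping.lookup m i))"

definition partial :: "'n::finite \<Rightarrow> 'n mpoly \<Rightarrow> 'n mpoly" where
  "partial i f =
     (\<Sum>m\<in>Poly_Mapping.keys f.
        Poly_Mapping.single (m - Poly_Mapping.single i 1)
          (real (Poly_Mapping.lookup m i) * Poly_Mapping.lookup f m))"

definition dir_deriv :: "real ^ 'n \<Rightarrow> 'n::finite mpoly \<Rightarrow> 'n mpoly" where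
  "dir_deriv a f = (\<Sum>i\<in>UNIV. Poly_Mapping.single 0 (a $ i) * partial i f)"

text \<open>\<open>dir_derivs [a\<^sub>1, \<dots>, a\<^sub>m] f\<close> is \<open>D\<^bsub>a\<^sub>1\<^esub> \<cdots> D\<^bsub>a\<^sub>m\<^esub> f\<close>; the case \<open>m = 0\<close> gives \<open>f\<close> itself.\<close>

definition dir_derivs :: "(real ^ 'n) list \<Rightarrow> 'n::finite mpoly \<Rightarrow> 'n mpoly" where
  "dir_derivs as f = foldr dir_deriv as f"


subsection \<open>Hessians, definiteness and eigenvalues\<close>

definition partial_fun :: "'n::finite \<Rightarrow> (real ^ 'n \<Rightarrow> real) \<Rightarrow> real ^ 'n \<Rightarrow> real" where
  "partial_fun i g x = deriv (\<lambda>t. g (x + t *\<^sub>R axis i 1)) 0"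

definition hessian :: "(real ^ 'n \<Rightarrow> real) \<Rightarrow> real ^ 'n \<Rightarrow> real ^ 'n::finite ^ 'n" where
  "hessian g a = (\<chi> i j. partial_fun i (partial_fun j g) a)"

definition hess_poly :: "'n::finite mpoly \<Rightarrow> real ^ 'n \<Rightarrow> real ^ 'n ^ 'n" where
  "hess_poly f a = hessian (poly_eval f) a"

definition neg_definite_on :: "(real ^ 'n) set \<Rightarrow> real ^ 'n::finite ^ 'n \<Rightarrow> bool" where
  "neg_definite_on S A \<longleftrightarrow> (\<forall>x\<in>S. x \<noteq> 0 \<longrightarrow> x \<bullet> (A *v x) < 0)"

definition neg_semidefinite_on :: "(real ^ 'n) set \<Rightarrow> real ^ 'n::finite ^ 'n \<Rightarrow> bool" where
  "neg_semidefinite_on S A \<longleftrightarrow> (\<forall>x\<in>S. x \<bullet> (A *v x) \<le> 0)"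

definition charpoly :: "real ^ 'n ^ 'n::finite \<Rightarrow> real poly" where
  "charpoly A = det (\<chi> i j. (if i = j then [:0, 1:] else 0) - [:A $ i $ j:])"

text \<open>Eigenvalues are counted with multiplicity: \<open>proots p\<close> is the multiset of roots of \<open>p\<close>.\<close>

definition num_pos_eigenvalues :: "real ^ 'n ^ 'n::finite \<Rightarrow> nat" where
  "num_pos_eigenvalues A = size (filter_mset (\<lambda>l. l > 0) (proots (charpoly A)))"


subsection \<open>Cones and complete log-concavity\<close>

definition proper_cone :: "(real ^ 'n::finite) set \<Rightarrow> bool" where
  "proper_cone K \<longleftrightarrow>
     K \<noteq> {} \<and> convex K \<and> cone K \<and> closed K \<and> K \<inter> uminus ` K = {0} \<and> interior K \<noteq> {}"

definition log_concave_at :: "'n::finite mpoly \<Rightarrow> real ^ 'n \<Rightarrow> bool" where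
  "log_concave_at f a \<longleftrightarrow>
     f = 0 \<or>
     poly_eval f a > 0 \<and> neg_semidefinite_on UNIV (hessian (\<lambda>x. ln (poly_eval f x)) a)"

definition strictly_log_concave_at :: "'n::finite mpoly \<Rightarrow> real ^ 'n \<Rightarrow> bool" where
  "strictly_log_concave_at f a \<longleftrightarrow>
     poly_eval f a > 0 \<and> neg_definite_on UNIV (hessian (\<lambda>x. ln (poly_eval f x)) a)"

definition K_CLC :: "(real ^ 'n) set \<Rightarrow> 'n::finite mpoly \<Rightarrow> bool" where
  "K_CLC K f \<longleftrightarrow>
     (\<forall>as. set as \<subseteq> K \<and> length as \<le> total_degree f \<longrightarrow>
        (\<forall>a\<in>interior K. log_concave_at (dir_derivs as f) a))"

definition strictly_K_CLC :: "(real ^ 'n) set \<Rightarrow> 'n::finite mpoly \<Rightarrow> bool" where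
  "strictly_K_CLC K f \<longleftrightarrow>
     (\<forall>as. set as \<subseteq> K \<and> length as \<le> total_degree f \<longrightarrow>
        (\<forall>a\<in>K. strictly_log_concave_at (dir_derivs as f) a))"

text \<open>Read literally, as in \<^const>\<open>strictly_K_CLC\<close>, the strict notion is not satisfied by any form of
  degree at least one: the point \<open>0\<close> belongs to \<open>K\<close> and such a form vanishes there, a direction
  \<open>a\<^sub>i = 0\<close> makes the derivative zero, and for \<open>m = d\<close> the derivative is a constant, whose logarithm
  has zero Hessian (likewise a singular Hessian for \<open>m = d - 1\<close> and at least two variables).
  The following version leaves out exactly these degenerate instances: points and directions are
  nonzero, and strictness is required of the derivatives of degree at least two.  It is implied by
  the literal version.\<close>

definition strictly_K_CLC_nondeg :: "(real ^ 'n) set \<Rightarrow> 'n::finite mpoly \<Rightarrow> bool" where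
  "strictly_K_CLC_nondeg K f \<longleftrightarrow>
     (\<forall>as. set as \<subseteq> K - {0} \<and> length as + 2 \<le> total_degree f \<longrightarrow>
        (\<forall>a\<in>K - {0}. strictly_log_concave_at (dir_derivs as f) a))"

end

theory Submission
  imports Defs
begin

text \<open>
  Everything happens in one symmetric bilinear form \<open>B(x,y) = x \<bullet> H y\<close>, where \<open>H\<close> is the Hessian of \<open>f\<close>
  at \<open>a\<close>.  Log-concavity of \<open>f\<close> at \<open>a\<close> says that \<open>f(a) B(x,x) \<le> (D\<^sub>x f (a))\<^sup>2\<close> for all \<open>x\<close>
  (\<open>hessian_ln\<close>).  Euler's identity for the derivatives of \<open>f\<close> gives \<open>B(x,a) = (d - 1) D\<^sub>x f (a)\<close> and
  \<open>B(a,a) = d (d - 1) f(a) > 0\<close>.  So \<open>B\<close> is positive at \<open>a\<close> and negative semidefinite on the hyperplane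
  \<open>(H a)\<^sup>\<bottom>\<close>, and negative definite there in the strict case (\<open>log_concave_at_hyperplane\<close>,
  \<open>strictly_log_concave_at_hyperplane\<close>).  A form that is positive somewhere and nonpositive on a
  hyperplane has exactly one positive eigenvalue; for the count with multiplicity the
  characteristic polynomial is factored along an orthonormal eigenbasis
  (\<open>num_pos_eigenvalues_hyperplane\<close>).

  Such a form satisfies a reversed Cauchy-Schwarz inequality, and therefore the distinguished vector
  \<open>a\<close> can be exchanged for any \<open>b\<close> with \<open>H b \<noteq> 0\<close> and \<open>B(b,b) \<ge> 0\<close> (with \<open>B(b,b) > 0\<close> in the strict
  case): this is \<open>neg_semidefinite_on_conjugate\<close> and \<open>neg_definite_on_conjugate\<close>.  What remains is the
  sign of \<open>B(b,b) = D\<^sub>b D\<^sub>b f (a)\<close> for \<open>b \<in> K\<close>, and here the hypotheses on the derivatives of \<open>f\<close> enter.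
  In the \<open>K\<close>-CLC case \<open>D\<^sub>b D\<^sub>b f\<close> is zero or positive at \<open>a\<close>.  In the nondegenerate strict case it is
  positive at \<open>a\<close> by hypothesis if \<open>d \<ge> 4\<close>, whereas for \<open>d = 2\<close> and \<open>d = 3\<close> the polynomial \<open>D\<^sub>b D\<^sub>b f\<close>
  has degree less than two and positivity is deduced from that of \<open>f\<close> and from the strict
  log-concavity of the quadratic form \<open>D\<^sub>b f\<close>, respectively (\<open>strictly_K_CLC_nondeg_hess_pos\<close>).
  The literal strict notion is contradictory for a form of positive degree, since \<open>0 \<in> K\<close> and
  \<open>f(0) = 0\<close>.
\<close>

text \<open>The infix \<open>$\<close> denotes components of vectors, not coefficients of power series.\<close>

unbundle no Formal_Power_Series.fps_syntax

section \<open>Calculus of multivariate polynomials\<close>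

lemma poly_mapping_sum_induct [case_names single add]:
  fixes f :: "'a \<Rightarrow>\<^sub>0 'b::comm_monoid_add"
  assumes single: "\<And>m c. P (Poly_Mapping.single m c)"
    and add: "\<And>f g. P f \<Longrightarrow> P g \<Longrightarrow> P (f + g)"
  shows "P f"
proof -
  have "f = (\<Sum>m\<in>Poly_Mapping.keys f. Poly_Mapping.single m (Poly_Mapping.lookup f m))"
    by (rule poly_mapping_eqI)
       (simp add: lookup_sum lookup_single when_def sum.delta in_keys_iff)
  moreover have "P (\<Sum>m\<in>S. Poly_Mapping.single m (c m))" if "finite S" for S c
    using that
  proof induction
    case empty
    show ?case using single[of undefined 0] by simp
  next
    case (insert m S)
    then show ?case by (simp add: add single)
  qed
  ultimately show ?thesis by (metis finite_keys)
qed

definition mon_eval :: "('n::finite \<Rightarrow>\<^sub>0 nat) \<Rightarrow> real ^ 'n \<Rightarrow> real" where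
  "mon_eval m x = (\<Prod>i\<in>UNIV. (x $ i) ^ Poly_Mapping.lookup m i)"

lemma poly_eval_superset:
  assumes "finite S" "Poly_Mapping.keys f \<subseteq> S"
  shows "poly_eval f x = (\<Sum>m\<in>S. Poly_Mapping.lookup f m * mon_eval m x)"
  unfolding poly_eval_def mon_eval_def
  by (rule sum.mono_neutral_left) (use assms in \<open>auto simp: in_keys_iff\<close>)

lemma poly_eval_single: "poly_eval (Poly_Mapping.single m c) x = c * mon_eval m x"
  by (subst poly_eval_superset[of "{m}"]) (auto simp: keys_single split: if_splits)

lemma poly_eval_add: "poly_eval (f + g) x = poly_eval f x + poly_eval g x"
proof -
  let ?S = "Poly_Mapping.keys f \<union> Poly_Mapping.keys g"
  have "Poly_Mapping.keys (f + g) \<subseteq> ?S" by (rule keys_add)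
  then show ?thesis
    by (simp add: poly_eval_superset[of ?S] lookup_add sum.distrib algebra_simps)
qed

lemma poly_eval_0 [simp]: "poly_eval 0 x = 0"
  by (simp add: poly_eval_def)

lemma poly_eval_sum: "poly_eval (\<Sum>i\<in>I. f i) x = (\<Sum>i\<in>I. poly_eval (f i) x)"
  by (induction I rule: infinite_finite_induct) (auto simp: poly_eval_add)

lemma poly_eval_scale: "poly_eval (Poly_Mapping.single 0 c * f) x = c * poly_eval f x"
  by (induction f rule: poly_mapping_sum_induct)
     (auto simp: mult_single poly_eval_single poly_eval_add algebra_simps)

lemma partial_superset:
  assumes "finite S" "Poly_Mapping.keys f \<subseteq> S"
  shows "partial i f = (\<Sum>m\<in>S. Poly_Mapping.single (m - Poly_Mapping.single i 1)
          (real (Poly_Mapping.lookup m i) * Poly_Mapping.lookup f m))"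
  unfolding partial_def
  by (rule sum.mono_neutral_left) (use assms in \<open>auto simp: in_keys_iff\<close>)

lemma partial_single:
  "partial i (Poly_Mapping.single m c) =
     Poly_Mapping.single (m - Poly_Mapping.single i 1) (real (Poly_Mapping.lookup m i) * c)"
  by (subst partial_superset[of "{m}"]) (auto simp: keys_single split: if_splits)

lemma partial_add: "partial i (f + g) = partial i f + partial i g"
proof -
  let ?S = "Poly_Mapping.keys f \<union> Poly_Mapping.keys g"
  have "Poly_Mapping.keys (f + g) \<subseteq> ?S" by (rule keys_add)
  then show ?thesis
    by (simp add: partial_superset[of ?S] lookup_add sum.distrib algebra_simps single_add)
qed

lemma partial_0 [simp]: "partial i 0 = 0"
  by (simp add: partial_def)

lemma partial_sum: "partial i (\<Sum>j\<in>I. f j) = (\<Sum>j\<in>I. partial i (f j))"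
  by (induction I rule: infinite_finite_induct) (auto simp: partial_add)

lemma partial_scale:
  "partial i (Poly_Mapping.single 0 c * f) = Poly_Mapping.single 0 c * partial i f"
  by (induction f rule: poly_mapping_sum_induct)
     (auto simp: mult_single partial_single partial_add algebra_simps)

text \<open>On a monomial both sides subtract the same exponents, and for \<open>i \<noteq> j\<close> the exponent of one
  variable is untouched by the other derivative.\<close>

lemma partial_commute: "partial i (partial j f) = partial j (partial i f)"
proof (induction f rule: poly_mapping_sum_induct)
  case (single m c)
  show ?case
    by (cases "i = j") (auto simp: partial_single lookup_minus lookup_single diff_diff_add algebra_simps)
next
  case (add f g)
  then show ?case by (simp add: partial_add)
qed

text \<open>The factor \<open>m\<^sub>i\<close> on both sides takes care of \<open>m\<^sub>i = 0\<close>, where the truncated subtraction leaves the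
  exponent \<open>0\<close> instead of \<open>-1\<close>.\<close>

lemma mon_eval_diff:
  "real (Poly_Mapping.lookup m i) * mon_eval (m - Poly_Mapping.single i 1) x =
   real (Poly_Mapping.lookup m i) * (x $ i) ^ (Poly_Mapping.lookup m i - 1) *
     (\<Prod>j\<in>UNIV - {i}. (x $ j) ^ Poly_Mapping.lookup m j)"
  by (simp add: mon_eval_def prod.remove[of UNIV i] lookup_minus lookup_single)

lemma mon_eval_has_derivative:
  "(mon_eval m has_derivative
     (\<lambda>h. \<Sum>i\<in>UNIV. h $ i * (real (Poly_Mapping.lookup m i) * mon_eval (m - Poly_Mapping.single i 1) x)))
   (at x)"
proof -
  have "((\<lambda>x. \<Prod>i\<in>UNIV. (x $ i) ^ Poly_Mapping.lookup m i) has_derivative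
     (\<lambda>h. \<Sum>i\<in>UNIV. (real (Poly_Mapping.lookup m i) * h $ i * (x $ i) ^ (Poly_Mapping.lookup m i - 1)) *
        (\<Prod>j\<in>UNIV - {i}. (x $ j) ^ Poly_Mapping.lookup m j))) (at x)"
    by (intro has_derivative_prod has_derivative_power bounded_linear_imp_has_derivative bounded_linear_vec_nth)
  then show ?thesis
    unfolding mon_eval_diff by (simp add: mon_eval_def[abs_def] mult_ac)
qed

text \<open>The bridge between the formal partial derivatives and analysis: every analytic derivative below
  is read off from this Frechet derivative.\<close>

lemma poly_eval_has_derivative:
  "(poly_eval f has_derivative (\<lambda>h. \<Sum>i\<in>UNIV. h $ i * poly_eval (partial i f) x)) (at x)"
proof (induction f rule: poly_mapping_sum_induct)
  case (single m c)
  have "((\<lambda>x. c * mon_eval m x) has_derivative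
     (\<lambda>h. c * (\<Sum>i\<in>UNIV. h $ i * (real (Poly_Mapping.lookup m i) * mon_eval (m - Poly_Mapping.single i 1) x)))) (at x)"
    by (intro has_derivative_mult_right mon_eval_has_derivative)
  then show ?case
    by (simp add: poly_eval_single[abs_def] partial_single sum_distrib_left mult_ac)
next
  case (add f g)
  have "((\<lambda>x. poly_eval f x + poly_eval g x) has_derivative (\<lambda>h. (\<Sum>i\<in>UNIV. h $ i * poly_eval (partial i f) x)
      + (\<Sum>i\<in>UNIV. h $ i * poly_eval (partial i g) x))) (at x)"
    by (intro has_derivative_add add)
  then show ?case
    by (simp add: poly_eval_add[abs_def] partial_add sum.distrib algebra_simps)
qed

lemma euler_identity:
  assumes "homogeneous d f"
  shows "(\<Sum>i\<in>UNIV. x $ i * poly_eval (partial i f) x) = real d * poly_eval f x"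
proof -
  have mon: "(\<Sum>i\<in>UNIV. x $ i * (real (Poly_Mapping.lookup m i) * mon_eval (m - Poly_Mapping.single i 1) x))
        = real (mon_degree m) * mon_eval m x" for m
  proof -
    have "x $ i * (real (Poly_Mapping.lookup m i) * mon_eval (m - Poly_Mapping.single i 1) x)
       = real (Poly_Mapping.lookup m i) * mon_eval m x" for i
      unfolding mon_eval_diff
      by (cases "Poly_Mapping.lookup m i") (auto simp: mon_eval_def prod.remove[of UNIV i])
    then show ?thesis by (simp only: mon_degree_def sum_distrib_right of_nat_sum)
  qed
  have "x $ i * poly_eval (partial i f) x = (\<Sum>m\<in>Poly_Mapping.keys f. Poly_Mapping.lookup f m *
      (x $ i * (real (Poly_Mapping.lookup m i) * mon_eval (m - Poly_Mapping.single i 1) x)))" for i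
    by (simp add: partial_def poly_eval_sum poly_eval_single sum_distrib_left mult_ac)
  then have "(\<Sum>i\<in>UNIV. x $ i * poly_eval (partial i f) x) =
     (\<Sum>m\<in>Poly_Mapping.keys f. \<Sum>i\<in>UNIV. Poly_Mapping.lookup f m *
      (x $ i * (real (Poly_Mapping.lookup m i) * mon_eval (m - Poly_Mapping.single i 1) x)))"
    by (simp only:) (rule sum.swap)
  also have "\<dots> = (\<Sum>m\<in>Poly_Mapping.keys f. Poly_Mapping.lookup f m * (real d * mon_eval m x))"
    using assms by (simp add: sum_distrib_left[symmetric] mon[simplified] homogeneous_def)
  also have "\<dots> = real d * poly_eval f x"
    by (simp add: poly_eval_superset[OF finite_keys order.refl] sum_distrib_left mult_ac)
  finally show ?thesis .
qed

lemma homogeneous_0 [simp]: "homogeneous d 0"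
  by (simp add: homogeneous_def)

lemma homogeneous_add: "homogeneous d f \<Longrightarrow> homogeneous d g \<Longrightarrow> homogeneous d (f + g)"
  using keys_add[of f g] by (auto simp: homogeneous_def)

lemma homogeneous_sum: "(\<And>i. i \<in> I \<Longrightarrow> homogeneous d (f i)) \<Longrightarrow> homogeneous d (\<Sum>i\<in>I. f i)"
  by (induction I rule: infinite_finite_induct) (auto intro: homogeneous_add)

lemma homogeneous_scale: "homogeneous d f \<Longrightarrow> homogeneous d (Poly_Mapping.single 0 c * f)"
  using keys_mult[of "Poly_Mapping.single 0 c" f]
  by (fastforce simp: homogeneous_def keys_single split: if_splits)

text \<open>A monomial free of \<open>x\<^sub>i\<close> contributes a zero coefficient and so drops out of the support; all
  others lose exactly one from their degree.\<close>

lemma homogeneous_partial: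
  assumes "homogeneous d f"
  shows "homogeneous (d - 1) (partial i f)"
  unfolding partial_def
proof (rule homogeneous_sum)
  fix m assume m: "m \<in> Poly_Mapping.keys f"
  show "homogeneous (d - 1) (Poly_Mapping.single (m - Poly_Mapping.single i 1)
          (real (Poly_Mapping.lookup m i) * Poly_Mapping.lookup f m))"
  proof (cases "Poly_Mapping.lookup m i")
    case (Suc k)
    have "mon_degree m = d" using m assms by (simp add: homogeneous_def)
    then have "mon_degree (m - Poly_Mapping.single i 1) = d - 1"
      using Suc by (auto simp: mon_degree_def sum.remove[of UNIV i] lookup_minus lookup_single)
    then show ?thesis by (simp add: homogeneous_def keys_single)
  qed simp
qed

lemma homogeneous_dir_deriv: "homogeneous d f \<Longrightarrow> homogeneous (d - 1) (dir_deriv a f)"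
  unfolding dir_deriv_def by (intro homogeneous_sum homogeneous_scale homogeneous_partial)

lemma total_degree_homogeneous:
  assumes "homogeneous d f" "f \<noteq> 0"
  shows "total_degree f = d"
proof -
  have "mon_degree ` Poly_Mapping.keys f = {d}"
    using assms by (auto simp: homogeneous_def image_def)
       (metis all_not_in_conv keys_eq_empty)
  then show ?thesis by (simp add: total_degree_def)
qed

lemma poly_eval_homogeneous_0_const:
  assumes "homogeneous 0 f"
  shows "poly_eval f x = poly_eval f y"
  unfolding poly_eval_def
  using assms by (intro sum.cong) (auto simp: homogeneous_def mon_degree_def)

lemma poly_eval_homogeneous_origin:
  assumes "homogeneous d f" "d \<ge> 1"
  shows "poly_eval f 0 = 0"
  using euler_identity[OF assms(1), of 0] assms(2) by simp

lemma poly_eval_dir_deriv: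
  "poly_eval (dir_deriv a f) x = (\<Sum>i\<in>UNIV. a $ i * poly_eval (partial i f) x)"
  by (simp add: dir_deriv_def poly_eval_sum poly_eval_scale)

lemma partial_dir_deriv: "partial i (dir_deriv a f) = dir_deriv a (partial i f)"
  by (simp add: dir_deriv_def partial_sum partial_scale partial_commute[of i])

section \<open>Eigenvalues of symmetric matrices\<close>

lemma symmetric_inner:
  fixes A :: "real ^ 'n ^ 'n::finite"
  assumes "transpose A = A"
  shows "x \<bullet> (A *v y) = y \<bullet> (A *v x)"
  using assms by (metis dot_lmul_matrix inner_commute vector_transpose_matrix)

text \<open>A maximiser \<open>v\<close> of the Rayleigh quotient on the unit sphere of \<open>S\<close> is an eigenvector: moving from
  \<open>v\<close> in the direction of the residual \<open>w = A v - l v\<close> would increase the quotient to first order by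
  \<open>2 t (w \<bullet> w)\<close>, so the residual vanishes.\<close>

lemma rayleigh_eigenvector:
  fixes A :: "real ^ 'n ^ 'n::finite"
  assumes sym: "transpose A = A" and S: "subspace S" "S \<noteq> {0}"
    and inv: "\<And>x. x \<in> S \<Longrightarrow> A *v x \<in> S"
  obtains v l where "v \<in> S" "norm v = 1" "A *v v = l *\<^sub>R v"
proof -
  let ?T = "S \<inter> sphere 0 1"
  obtain u where u: "u \<in> S" "u \<noteq> 0" using S subspace_0 by auto
  have "(1 / norm u) *\<^sub>R u \<in> ?T" using u S by (simp add: subspace_scale)
  then have "?T \<noteq> {}" by blast
  moreover have "compact ?T"
    by (simp add: S(1) closed_Int_compact closed_subspace)
  moreover have "continuous_on ?T (\<lambda>x. x \<bullet> (A *v x))"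
    by (intro continuous_intros matrix_vector_mult_linear_continuous_on)
  ultimately obtain v where v: "v \<in> ?T" and max: "\<And>x. x \<in> ?T \<Longrightarrow> x \<bullet> (A *v x) \<le> v \<bullet> (A *v v)"
    using continuous_attains_sup[of ?T "\<lambda>x. x \<bullet> (A *v x)"] by blast
  define l where "l = v \<bullet> (A *v v)"
  have vv: "v \<bullet> v = 1" "v \<in> S" using v by (auto simp: dot_square_norm)
  have bound: "x \<bullet> (A *v x) \<le> l * (x \<bullet> x)" if "x \<in> S" for x
  proof (cases "x = 0")
    case False
    then have "(1 / norm x) *\<^sub>R x \<in> ?T" using that S by (simp add: subspace_scale)
    from max[OF this] have "(x \<bullet> (A *v x)) / (norm x)\<^sup>2 \<le> l"
      by (simp add: l_def matrix_vector_mult_scaleR power2_eq_square)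
    then show ?thesis using False by (simp add: dot_square_norm divide_le_eq)
  qed simp
  define w where "w = A *v v - l *\<^sub>R v"
  have w: "w \<in> S" unfolding w_def using inv vv S by (simp add: subspace_diff subspace_scale)
  have vw: "v \<bullet> w = 0" by (simp add: w_def inner_diff_right vv l_def)
  have wAv: "w \<bullet> (A *v v) = w \<bullet> w"
    using vw by (simp add: w_def inner_diff_right inner_diff_left inner_commute)
  define c where "c = l * (w \<bullet> w) - w \<bullet> (A *v w)"
  have key: "2 * t * (w \<bullet> w) \<le> t\<^sup>2 * c" for t :: real
  proof -
    have "v + t *\<^sub>R w \<in> S" using vv w S by (simp add: subspace_add subspace_scale)
    from bound[OF this] show ?thesis
      using symmetric_inner[OF sym, of v w] vw wAv
      by (simp add: matrix_vector_right_distrib matrix_vector_mult_scaleR inner_add_left inner_add_right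
          inner_commute[of w v] vv l_def[symmetric] c_def power2_eq_square algebra_simps)
  qed
  have "w \<bullet> w \<le> 0"
  proof (rule ccontr)
    assume *: "\<not> w \<bullet> w \<le> 0"
    \<comment> \<open>small enough that \<open>t c \<le> w \<bullet> w\<close>; the \<open>1\<close> keeps the denominator positive\<close>
    define t where "t = (w \<bullet> w) / (\<bar>c\<bar> + 1)"
    have t: "t > 0" unfolding t_def by (rule divide_pos_pos) (use * in linarith)+
    have "2 * t * (w \<bullet> w) \<le> t * (t * c)" using key[of t] by (simp add: power2_eq_square mult.assoc)
    then have "2 * (w \<bullet> w) \<le> t * c" using t by (simp add: mult.assoc mult.left_commute)
    also have "t * c \<le> t * (\<bar>c\<bar> + 1)" using t by (intro mult_left_mono) auto
    also have "\<dots> = w \<bullet> w" by (simp add: t_def)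
    finally show False using * by simp
  qed
  then have "w = 0" by (metis inner_gt_zero_iff not_less)
  then have "A *v v = l *\<^sub>R v" by (simp add: w_def)
  then show ?thesis using that v by auto
qed

text \<open>The orthogonal complement of an eigenvector inside an invariant subspace is again invariant,
  because \<open>A\<close> is self-adjoint; hence eigenvectors can be split off one at a time.\<close>

lemma orthonormal_eigenbasis_subspace:
  fixes A :: "real ^ 'n ^ 'n::finite"
  assumes sym: "transpose A = A" and S: "subspace S"
    and inv: "\<And>x. x \<in> S \<Longrightarrow> A *v x \<in> S"
  shows "\<exists>B\<subseteq>S. pairwise orthogonal B \<and> (\<forall>v\<in>B. norm v = 1 \<and> (\<exists>l. A *v v = l *\<^sub>R v)) \<and> S \<subseteq> span B"
  using S inv
proof (induction "dim S" arbitrary: S rule: less_induct)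
  case less
  show ?case
  proof (cases "S = {0}")
    case True
    then show ?thesis by (intro exI[of _ "{}"]) (auto simp: pairwise_def)
  next
    case False
    obtain v l where v: "v \<in> S" "norm v = 1" "A *v v = l *\<^sub>R v"
      using rayleigh_eigenvector[OF sym less.prems(1) False less.prems(2)] by metis
    have vv: "v \<bullet> v = 1" using v by (simp add: dot_square_norm)
    define S' where "S' = S \<inter> {y. orthogonal v y}"
    have sub: "subspace S'" unfolding S'_def
      by (intro subspace_inter less.prems subspace_orthogonal_to_vector)
    have inv': "A *v x \<in> S'" if "x \<in> S'" for x
      using that less.prems(2) symmetric_inner[OF sym, of v x] v(3)
      by (auto simp: S'_def orthogonal_def inner_commute)
    have "v \<notin> S'" using vv by (simp add: S'_def orthogonal_def)
    then have "S' \<subset> S" using v by (auto simp: S'_def)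
    then have "dim S' < dim S"
      using sub less.prems(1) by (metis dim_psubset span_eq_iff)
    from less.hyps[OF this sub inv'] obtain B where B: "B \<subseteq> S'" "pairwise orthogonal B"
      "\<forall>v\<in>B. norm v = 1 \<and> (\<exists>l. A *v v = l *\<^sub>R v)" "S' \<subseteq> span B" by blast
    have "S \<subseteq> span (insert v B)"
    proof
      fix x assume x: "x \<in> S"
      have "x - (v \<bullet> x) *\<^sub>R v \<in> S'"
        using x v(1) less.prems(1) vv
        by (simp add: S'_def orthogonal_def inner_diff_right subspace_diff subspace_scale)
      then show "x \<in> span (insert v B)" using B(4) span_breakdown_eq by blast
    qed
    moreover have "pairwise orthogonal (insert v B)"
      using B(1,2) by (auto simp: pairwise_insert S'_def orthogonal_commute)
    ultimately show ?thesis
      using B v \<open>S' \<subset> S\<close> by (intro exI[of _ "insert v B"]) auto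
  qed
qed

text \<open>Indexing the eigenbasis by the coordinate type makes it the set of columns of a square matrix.\<close>

lemma orthonormal_eigenbasis:
  fixes A :: "real ^ 'n ^ 'n::finite"
  assumes sym: "transpose A = A"
  obtains v :: "'n \<Rightarrow> real ^ 'n" and l :: "'n \<Rightarrow> real"
  where "\<And>i j. v i \<bullet> v j = (if i = j then 1 else 0)" "\<And>i. A *v v i = l i *\<^sub>R v i"
proof -
  obtain B where B: "pairwise orthogonal B" "\<forall>v\<in>B. norm v = 1 \<and> (\<exists>l. A *v v = l *\<^sub>R v)" 
      "UNIV \<subseteq> span B"
    using orthonormal_eigenbasis_subspace[OF sym subspace_UNIV] by auto
  have ind: "independent B" using B by (intro pairwise_orthogonal_independent) auto
  then have "finite B" by (rule independent_imp_finite)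
  moreover have "card B = CARD('n)"
    using basis_card_eq_dim[OF subset_UNIV B(3) ind] by simp
  ultimately obtain v where v: "bij_betw v (UNIV :: 'n set) B"
    by (metis finite_same_card_bij finite)
  then have vB: "v i \<in> B" for i by (auto simp: bij_betw_def)
  have "\<forall>i. \<exists>l. A *v v i = l *\<^sub>R v i" using B(2) vB by blast
  then obtain l where "\<And>i. A *v v i = l i *\<^sub>R v i" by metis
  moreover have "v i \<bullet> v j = (if i = j then 1 else 0)" for i j
    using B(1,2) vB[of i] vB[of j] bij_betw_imp_inj_on[OF v]
    by (cases "i = j") (force simp: pairwise_def orthogonal_def inj_def dot_square_norm)+
  ultimately show ?thesis using that by blast
qed

lemma poly_charpoly: "poly (charpoly A) x = det (mat x - A)"
  by (simp add: charpoly_def det_def poly_sum poly_prod mat_def if_distrib[of "\<lambda>p. poly p x"]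
      of_int_poly cong: if_cong)

text \<open>With the eigenvectors as columns of \<open>P\<close>, the identity \<open>(x - A) P = P D\<close> with \<open>D\<close> diagonal gives
  the value of the characteristic polynomial at each real \<open>x\<close>, and a real polynomial is determined
  by its values.  Working pointwise avoids matrices over the ring of polynomials.\<close>

lemma charpoly_eigenbasis:
  fixes A :: "real ^ 'n ^ 'n::finite"
  fixes v :: "'n \<Rightarrow> real ^ 'n"
  assumes orth: "\<And>i j. v i \<bullet> v j = (if i = j then 1 else (0::real))"
    and eig: "\<And>i. A *v v i = l i *\<^sub>R v i"
  shows "charpoly A = (\<Prod>i\<in>UNIV. [:- l i, 1:])"
proof -
  define P where "P = (\<chi> i j. v j $ i)"
  have col: "column i P = v i" for i by (simp add: P_def column_def)
  have "orthogonal_matrix P"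
    unfolding orthogonal_matrix_orthonormal_columns col
    by (simp add: orth norm_eq_sqrt_inner orthogonal_def)
  then have PP: "transpose P ** P = mat 1" by (simp add: orthogonal_matrix)
  have "poly (charpoly A) x = (\<Prod>i\<in>UNIV. x - l i)" for x
  proof -
    define D where "D = (\<chi> i j. if i = j then x - l i else 0)"
    have "(mat x - A) *v v j = (x - l j) *\<^sub>R v j" for j
      by (simp add: matrix_vector_mult_diff_rdistrib eig algebra_simps)
        (simp add: matrix_vector_mult_def mat_def vec_eq_iff if_distrib if_distribR cong: if_cong)
    then have "(mat x - A) ** P = P ** D"
      by (simp add: vec_eq_iff matrix_matrix_mult_def matrix_vector_mult_def P_def D_def if_distrib cong: if_cong)
    then have "det (mat x - A) * det P = det P * det D" by (metis det_mul)
    moreover have "det P \<noteq> 0"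
      using PP by (metis det_I det_mul mult_zero_right zero_neq_one)
    moreover have "det D = (\<Prod>i\<in>UNIV. x - l i)"
      by (subst det_diagonal) (auto simp: D_def)
    ultimately show ?thesis by (simp add: poly_charpoly)
  qed
  then have "poly (charpoly A) = poly (\<Prod>i\<in>UNIV. [:- l i, 1:])"
    by (auto simp: poly_prod fun_eq_iff)
  then show ?thesis by (simp add: poly_eq_poly_eq_iff)
qed

lemma num_pos_eigenvalues_eigenbasis:
  fixes A :: "real ^ 'n ^ 'n::finite"
  fixes v :: "'n \<Rightarrow> real ^ 'n"
  assumes "\<And>i j. v i \<bullet> v j = (if i = j then 1 else (0::real))"
    and "\<And>i. A *v v i = l i *\<^sub>R v i"
  shows "num_pos_eigenvalues A = card {i. l i > 0}"
proof -
  have "proots (charpoly A) = (\<Sum>i\<in>UNIV. {#l i#})"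
    unfolding charpoly_eigenbasis[OF assms] by (subst proots_prod) auto
  moreover have "size (filter_mset (\<lambda>x. x > 0) (\<Sum>i\<in>I. {#l i#})) = card {i\<in>I. l i > 0}"
    if "finite I" for I
    using that
  proof induction
    case (insert i I)
    then have "{j \<in> insert i I. l j > 0} = (if l i > 0 then insert i {j \<in> I. l j > 0} else {j \<in> I. l j > 0})"
      by auto
    then show ?case using insert by simp
  qed simp
  ultimately show ?thesis by (simp add: num_pos_eigenvalues_def)
qed

section \<open>Forms that are nonpositive on a hyperplane\<close>

text \<open>If all eigenvalues were nonpositive, the form would be nonpositive at \<open>a\<close>.  If two of them were
  positive, the form would be positive definite on the plane of their eigenvectors, and that plane
  meets the hyperplane \<open>(A a)\<^sup>\<bottom>\<close> in a nonzero vector.\<close>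

lemma num_pos_eigenvalues_hyperplane:
  fixes A :: "real ^ 'n ^ 'n::finite"
  assumes sym: "transpose A = A" and pos: "a \<bullet> (A *v a) > 0"
    and nsd: "\<And>x. x \<bullet> (A *v a) = 0 \<Longrightarrow> x \<bullet> (A *v x) \<le> 0"
  shows "num_pos_eigenvalues A = 1"
proof -
  obtain v :: "'n \<Rightarrow> real ^ 'n" and l where orth: "\<And>i j. v i \<bullet> v j = (if i = j then 1 else 0)"
    and eig: "\<And>i. A *v v i = l i *\<^sub>R v i"
    using orthonormal_eigenbasis[OF sym] by metis
  have quad: "v i \<bullet> (A *v v j) = (if i = j then l i else 0)" for i j
    by (simp add: eig orth)
  have "\<exists>i. l i > 0"
  proof (rule ccontr)
    assume no: "\<nexists>i. l i > 0"
    have inj: "inj v"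
    proof (rule injI)
      fix i j assume "v i = v j"
      then have "v i \<bullet> v j = 1" by (simp add: orth)
      then show "i = j" by (simp add: orth split: if_splits)
    qed
    have po: "pairwise orthogonal (range v)" by (auto simp: pairwise_def orthogonal_def orth)
    have "0 \<notin> range v" using orth by (metis (no_types, lifting) inner_zero_left rangeE zero_neq_one)
    then have "independent (range v)" using po by (rule pairwise_orthogonal_independent[rotated])
    then have "UNIV \<subseteq> span (range v)"
      using card_eq_dim[of "range v" UNIV] by (simp add: card_image[OF inj])
    then have "a \<in> span (range v)" by blast
    then have "(\<Sum>u\<in>range v. (a \<bullet> u) *\<^sub>R u) = a"
      by (intro orthonormal_basis_expand po) (auto simp: norm_eq_sqrt_inner orth)
    then have a: "a = (\<Sum>i\<in>UNIV. (a \<bullet> v i) *\<^sub>R v i)"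
      by (simp add: sum.reindex[OF inj] o_def)
    have "A *v a = (\<Sum>i\<in>UNIV. (a \<bullet> v i) *\<^sub>R (l i *\<^sub>R v i))"
      by (subst a) (simp only: linear_sum[OF matrix_vector_mul_linear] matrix_vector_mult_scaleR eig)
    then have "a \<bullet> (A *v a) = (\<Sum>i\<in>UNIV. l i * (a \<bullet> v i)\<^sup>2)"
      by (simp add: inner_sum_right power2_eq_square mult_ac)
    also have "\<dots> \<le> 0" using no by (intro sum_nonpos mult_nonpos_nonneg) (auto simp: not_less)
    finally show False using pos by simp
  qed
  moreover have "i = j" if ij: "l i > 0" "l j > 0" for i j
  proof (rule ccontr)
    assume ne: "i \<noteq> j"
    define p q where "p = v j \<bullet> (A *v a)" and "q = v i \<bullet> (A *v a)"
    define z where "z = p *\<^sub>R v i - q *\<^sub>R v j"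
    have "z \<bullet> (A *v a) = 0" by (simp add: z_def p_def q_def inner_diff_left)
    from nsd[OF this] have "p\<^sup>2 * l i + q\<^sup>2 * l j \<le> 0"
      using ne by (simp add: z_def matrix_vector_mult_diff_distrib matrix_vector_mult_scaleR
            inner_diff_left inner_diff_right quad power2_eq_square algebra_simps)
    moreover have "p\<^sup>2 * l i \<ge> 0" "q\<^sup>2 * l j \<ge> 0" using ij by auto
    ultimately have "q\<^sup>2 * l j = 0" by linarith
    then have "q = 0" using ij by simp
    from nsd[OF this[unfolded q_def]] show False using ij by (simp add: quad)
  qed
  ultimately have "\<exists>i. {i. l i > 0} = {i}" by blast
  then show ?thesis using num_pos_eigenvalues_eigenbasis[OF orth eig] by auto
qed

text \<open>Suppose \<open>B(x,x) > 0\<close> and \<open>B(x,b) = 0\<close>, with \<open>B(x,y) = x \<bullet> A y\<close>.  The vector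
  \<open>z = B(b,a) x - B(x,a) b\<close> lies in \<open>(A a)\<^sup>\<bottom>\<close>, and \<open>B(z,z) \<le> 0\<close> forces \<open>B(b,a) = 0\<close>.  Then \<open>b\<close> is isotropic
  for a form that is negative semidefinite on \<open>(A a)\<^sup>\<bottom>\<close>, so it lies in the radical there; being
  orthogonal to \<open>a\<close> as well, it is in the kernel of \<open>A\<close>, contrary to \<open>A b \<noteq> 0\<close>.\<close>

lemma neg_semidefinite_on_conjugate:
  fixes A :: "real ^ 'n ^ 'n::finite"
  assumes sym: "transpose A = A" and pos: "a \<bullet> (A *v a) > 0"
    and nsd: "\<And>x. x \<bullet> (A *v a) = 0 \<Longrightarrow> x \<bullet> (A *v x) \<le> 0"
    and b: "b \<bullet> (A *v b) \<ge> 0" "A *v b \<noteq> 0"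
  shows "neg_semidefinite_on ({A *v b}\<^sup>\<bottom>) A"
  unfolding neg_semidefinite_on_def
proof (intro ballI, rule ccontr)
  note S = symmetric_inner[OF sym]
  note expand = matrix_vector_mult_diff_distrib matrix_vector_right_distrib matrix_vector_mult_scaleR
     inner_diff_left inner_diff_right inner_add_left inner_add_right
  fix x assume "x \<in> {A *v b}\<^sup>\<bottom>" and "\<not> x \<bullet> (A *v x) \<le> 0"
  then have xb: "x \<bullet> (A *v b) = 0" and xx: "x \<bullet> (A *v x) > 0"
    by (auto simp: orthogonal_comp_def orthogonal_def inner_commute)
  define p q where "p = b \<bullet> (A *v a)" and "q = x \<bullet> (A *v a)"
  define z where "z = p *\<^sub>R x - q *\<^sub>R b"
  have "z \<bullet> (A *v a) = 0" by (simp add: z_def p_def q_def inner_diff_left)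
  from nsd[OF this] have "p\<^sup>2 * (x \<bullet> (A *v x)) + q\<^sup>2 * (b \<bullet> (A *v b)) \<le> 0"
    using xb S[of b x] by (simp add: z_def expand power2_eq_square algebra_simps)
  moreover have "p\<^sup>2 * (x \<bullet> (A *v x)) \<ge> 0" "q\<^sup>2 * (b \<bullet> (A *v b)) \<ge> 0" using xx b by auto
  ultimately have "p\<^sup>2 * (x \<bullet> (A *v x)) = 0" by linarith
  then have "p = 0" using xx by simp
  then have ba: "b \<bullet> (A *v a) = 0" by (simp add: p_def)
  have bb: "b \<bullet> (A *v b) = 0" using nsd[OF ba] b(1) by simp
  have perp: "y \<bullet> (A *v b) = 0" if ya: "y \<bullet> (A *v a) = 0" for y
  proof -
    define r s where "r = y \<bullet> (A *v b)" and "s = y \<bullet> (A *v y)"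
    have "2 * t * r + s \<le> 0" for t
    proof -
      have "(y + t *\<^sub>R b) \<bullet> (A *v a) = 0" using ya ba by (simp add: inner_add_left)
      from nsd[OF this] show ?thesis
        using bb S[of b y] by (simp add: expand r_def s_def algebra_simps)
    qed
    \<comment> \<open>at this \<open>t\<close> the left-hand side equals \<open>1\<close>\<close>
    from this[of "(1 - s) / (2 * r)"] have "r = 0" by (cases "r = 0") (auto simp: field_simps)
    then show ?thesis by (simp add: r_def)
  qed
  have "y \<bullet> (A *v b) = 0" for y
  proof -
    \<comment> \<open>the coefficient of \<open>a\<close> in the splitting of \<open>y\<close> along \<open>a\<close> and \<open>(A a)\<^sup>\<bottom>\<close>\<close>
    define c where "c = (y \<bullet> (A *v a)) / (a \<bullet> (A *v a))"
    have "(y - c *\<^sub>R a) \<bullet> (A *v a) = 0" using pos by (simp add: c_def inner_diff_left)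
    from perp[OF this] show ?thesis using ba S[of a b] by (simp add: inner_diff_left)
  qed
  then show False using b(2) inner_eq_zero_iff by blast
qed

text \<open>If \<open>B(x,x) \<ge> 0\<close> and \<open>B(x,b) = 0\<close>, then \<open>z = B(b,a) x - B(x,a) b\<close> lies in \<open>(A a)\<^sup>\<bottom>\<close> and satisfies
  \<open>B(z,z) \<ge> 0\<close>.  So \<open>z = 0\<close>, and \<open>x\<close> would be a multiple of \<open>b\<close>, on which the form is positive.\<close>

lemma neg_definite_on_conjugate:
  fixes A :: "real ^ 'n ^ 'n::finite"
  assumes sym: "transpose A = A"
    and nd: "\<And>x. x \<bullet> (A *v a) = 0 \<Longrightarrow> x \<noteq> 0 \<Longrightarrow> x \<bullet> (A *v x) < 0"
    and b: "b \<bullet> (A *v b) > 0"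
  shows "neg_definite_on ({A *v b}\<^sup>\<bottom>) A"
  unfolding neg_definite_on_def
proof (intro ballI impI, rule ccontr)
  fix x assume "x \<in> {A *v b}\<^sup>\<bottom>" and x0: "x \<noteq> 0" and "\<not> x \<bullet> (A *v x) < 0"
  then have xb: "x \<bullet> (A *v b) = 0" and xx: "x \<bullet> (A *v x) \<ge> 0"
    by (auto simp: orthogonal_comp_def orthogonal_def inner_commute)
  define p q where "p = b \<bullet> (A *v a)" and "q = x \<bullet> (A *v a)"
  define z where "z = p *\<^sub>R x - q *\<^sub>R b"
  have za: "z \<bullet> (A *v a) = 0" by (simp add: z_def p_def q_def inner_diff_left)
  have "z \<bullet> (A *v z) = p\<^sup>2 * (x \<bullet> (A *v x)) + q\<^sup>2 * (b \<bullet> (A *v b))"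
    using xb symmetric_inner[OF sym, of b x]
    by (simp add: z_def matrix_vector_mult_diff_distrib matrix_vector_mult_scaleR
     inner_diff_left inner_diff_right power2_eq_square algebra_simps)
  also have "\<dots> \<ge> 0" using xx b by simp
  finally have "z = 0" using nd[OF za] by force
  then have eq: "p *\<^sub>R x = q *\<^sub>R b" by (simp add: z_def)
  have "b \<noteq> 0" using b by auto
  then have "p \<noteq> 0" using nd[of b] b by (auto simp: p_def)
  have "q * (b \<bullet> (A *v b)) = (p *\<^sub>R x) \<bullet> (A *v b)" unfolding eq by simp
  then have "q = 0" using xb b by simp
  then show False using eq \<open>p \<noteq> 0\<close> x0 by simp
qed

text \<open>A kernel vector is orthogonal to \<open>A a\<close> by symmetry and isotropic.\<close>

lemma invertible_neg_definite_hyperplane: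
  fixes A :: "real ^ 'n ^ 'n::finite"
  assumes sym: "transpose A = A"
    and nd: "\<And>x. x \<bullet> (A *v a) = 0 \<Longrightarrow> x \<noteq> 0 \<Longrightarrow> x \<bullet> (A *v x) < 0"
  shows "invertible A"
proof -
  have "x = 0" if "A *v x = 0" for x
    using that nd[of x] symmetric_inner[OF sym, of x a] by force
  then show ?thesis
    unfolding invertible_left_inverse matrix_left_invertible_ker by blast
qed

section \<open>Hessians of polynomials and of their logarithms\<close>

text \<open>Allowing \<open>h\<close> to agree with \<open>g\<close> only near \<open>x\<close> is what makes iterated partial derivatives of
  \<open>ln \<circ> f\<close> accessible: the formula for the first derivative holds only where \<open>f\<close> is positive.\<close>

lemma partial_fun_has_derivative:
  assumes g: "(g has_derivative g') (at x)" and S: "open S" "x \<in> S" "\<And>y. y \<in> S \<Longrightarrow> h y = g y"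
  shows "partial_fun i h x = g' (axis i 1)"
proof -
  have h: "(h has_derivative g') (at x)"
    by (rule has_derivative_transform_within_open[OF g S(1,2)]) (simp add: S(3))
  have "((\<lambda>t. h (x + t *\<^sub>R axis i 1)) has_derivative (\<lambda>t. g' (t *\<^sub>R axis i 1))) (at 0)"
    by (rule has_derivative_compose[of "\<lambda>t. x + t *\<^sub>R axis i 1" "\<lambda>t. t *\<^sub>R axis i 1"])
       (auto intro!: derivative_eq_intros h)
  then have "((\<lambda>t. h (x + t *\<^sub>R axis i 1)) has_field_derivative g' (axis i 1)) (at 0)"
    by (rule has_derivative_imp_has_field_derivative)
       (simp add: linear_scale[OF has_derivative_linear[OF g]])
  then show ?thesis unfolding partial_fun_def by (rule DERIV_imp_deriv)
qed

lemma sum_axis [simp]: "(\<Sum>j\<in>UNIV. axis i (1::real) $ j * c j) = c (i::'n::finite)"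
  by (simp add: axis_def if_distrib if_distribR cong: if_cong)

lemma partial_fun_poly_eval: "partial_fun i (poly_eval f) = poly_eval (partial i f)"
  by (rule ext) (subst partial_fun_has_derivative[OF poly_eval_has_derivative open_UNIV], auto)

lemma hess_poly_nth: "hess_poly f a $ i $ j = poly_eval (partial i (partial j f)) a"
  by (simp add: hess_poly_def hessian_def partial_fun_poly_eval)

lemma transpose_hess_poly: "transpose (hess_poly f a) = hess_poly f a"
  by (simp add: vec_eq_iff transpose_def hess_poly_nth partial_commute)

lemma hess_poly_mult_nth: "(hess_poly f a *v b) $ i = poly_eval (partial i (dir_deriv b f)) a"
  by (simp add: matrix_vector_mult_def hess_poly_nth poly_eval_dir_deriv partial_dir_deriv
      partial_commute[of i] mult.commute)

lemma inner_hess_poly: "c \<bullet> (hess_poly f a *v b) = poly_eval (dir_deriv c (dir_deriv b f)) a"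
  by (simp add: inner_vec_def hess_poly_mult_nth poly_eval_dir_deriv)

lemma poly_eval_dir_deriv_self:
  "homogeneous d f \<Longrightarrow> poly_eval (dir_deriv a f) a = real d * poly_eval f a"
  by (simp add: poly_eval_dir_deriv euler_identity)

text \<open>Euler's identity for \<open>D\<^sub>x f\<close>, which is homogeneous of degree \<open>d - 1\<close>.  It turns orthogonality to
  \<open>H a\<close> into orthogonality to the gradient of \<open>f\<close> at \<open>a\<close>.\<close>

lemma inner_hess_poly_point:
  assumes "homogeneous d f"
  shows "x \<bullet> (hess_poly f a *v a) = real (d - 1) * poly_eval (dir_deriv x f) a"
proof -
  have "x \<bullet> (hess_poly f a *v a) = a \<bullet> (hess_poly f a *v x)"
    by (rule symmetric_inner[OF transpose_hess_poly])
  also have "\<dots> = real (d - 1) * poly_eval (dir_deriv x f) a"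
    unfolding inner_hess_poly
    by (rule poly_eval_dir_deriv_self[OF homogeneous_dir_deriv[OF assms]])
  finally show ?thesis .
qed

text \<open>The quotient rule, applied to \<open>\<partial>\<^sub>j f / f\<close>.\<close>

lemma hessian_ln:
  fixes f :: "'n::finite mpoly"
  assumes pos: "poly_eval f a > 0"
  shows "x \<bullet> (hessian (\<lambda>y. ln (poly_eval f y)) a *v x) =
     (poly_eval f a * (x \<bullet> (hess_poly f a *v x)) - (poly_eval (dir_deriv x f) a)\<^sup>2) / (poly_eval f a)\<^sup>2"
proof -
  define S where "S = {y. poly_eval f y > 0}"
  have cont: "continuous_on UNIV (poly_eval f)"
    by (meson continuous_at_imp_continuous_on has_derivative_continuous poly_eval_has_derivative)
  have S: "open S" unfolding S_def
    by (rule open_Collect_less) (auto intro: cont continuous_on_const)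
  have first: "partial_fun j (\<lambda>y. ln (poly_eval f y)) y = poly_eval (partial j f) y / poly_eval f y"
    if "y \<in> S" for j y
  proof -
    have "((\<lambda>y. ln (poly_eval f y)) has_derivative
       (\<lambda>h. (\<Sum>i\<in>UNIV. h $ i * poly_eval (partial i f) y) / poly_eval f y)) (at y)"
      using that by (auto intro!: derivative_eq_intros poly_eval_has_derivative simp: S_def divide_inverse)
    from partial_fun_has_derivative[OF this open_UNIV] show ?thesis by simp
  qed
  have second: "hessian (\<lambda>y. ln (poly_eval f y)) a $ i $ j =
     (poly_eval f a * hess_poly f a $ i $ j - poly_eval (partial i f) a * poly_eval (partial j f) a)
       / (poly_eval f a)\<^sup>2" for i j
  proof -
    have "((\<lambda>y. poly_eval (partial j f) y / poly_eval f y) has_derivative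
       (\<lambda>h. ((\<Sum>i\<in>UNIV. h $ i * poly_eval (partial i (partial j f)) a) * poly_eval f a -
             poly_eval (partial j f) a * (\<Sum>i\<in>UNIV. h $ i * poly_eval (partial i f) a))
             / (poly_eval f a * poly_eval f a))) (at a)"
      using pos by (intro has_derivative_divide' poly_eval_has_derivative) auto
    from partial_fun_has_derivative[OF this S, of "partial_fun j (\<lambda>y. ln (poly_eval f y))" i]
    have "partial_fun i (partial_fun j (\<lambda>y. ln (poly_eval f y))) a =
       (poly_eval (partial i (partial j f)) a * poly_eval f a - poly_eval (partial j f) a * poly_eval (partial i f) a)
         / (poly_eval f a * poly_eval f a)"
      using pos first by (simp add: S_def)
    then show ?thesis
      by (simp add: hessian_def hess_poly_nth power2_eq_square mult.commute)
  qed
  have "x \<bullet> (hessian (\<lambda>y. ln (poly_eval f y)) a *v x) =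
    (\<Sum>i\<in>UNIV. \<Sum>j\<in>UNIV. x $ i * x $ j *
        (poly_eval f a * hess_poly f a $ i $ j - poly_eval (partial i f) a * poly_eval (partial j f) a)) / (poly_eval f a)\<^sup>2"
    by (simp add: inner_vec_def matrix_vector_mult_def second sum_divide_distrib sum_distrib_left mult_ac)
  also have "(\<Sum>i\<in>UNIV. \<Sum>j\<in>UNIV. x $ i * x $ j *
        (poly_eval f a * hess_poly f a $ i $ j - poly_eval (partial i f) a * poly_eval (partial j f) a))
     = poly_eval f a * (\<Sum>i\<in>UNIV. \<Sum>j\<in>UNIV. x $ i * (hess_poly f a $ i $ j * x $ j)) -
       (\<Sum>i\<in>UNIV. x $ i * poly_eval (partial i f) a) * (\<Sum>j\<in>UNIV. x $ j * poly_eval (partial j f) a)"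
    by (simp add: right_diff_distrib sum_subtractf sum_distrib_left sum_product mult_ac)
  also have "\<dots> = poly_eval f a * (x \<bullet> (hess_poly f a *v x)) - (poly_eval (dir_deriv x f) a)\<^sup>2"
    by (simp add: inner_vec_def matrix_vector_mult_def sum_distrib_left poly_eval_dir_deriv power2_eq_square)
  finally show ?thesis .
qed

section \<open>Complete log-concavity\<close>

text \<open>On \<open>(H a)\<^sup>\<bottom>\<close> the derivative \<open>D\<^sub>x f (a)\<close> vanishes, so the negative term in \<open>hessian_ln\<close> disappears and
  the sign of the Hessian of \<open>ln \<circ> f\<close> is that of the Hessian of \<open>f\<close>.\<close>

lemma log_concave_at_hyperplane:
  assumes hom: "homogeneous d f" and d: "d \<ge> 2" and lc: "log_concave_at f a" "f \<noteq> 0"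
  shows "a \<bullet> (hess_poly f a *v a) > 0"
    and "x \<bullet> (hess_poly f a *v a) = 0 \<Longrightarrow> x \<bullet> (hess_poly f a *v x) \<le> 0"
proof -
  have pos: "poly_eval f a > 0"
    and nsd: "x \<bullet> (hessian (\<lambda>x. ln (poly_eval f x)) a *v x) \<le> 0"
    using lc by (auto simp: log_concave_at_def neg_semidefinite_on_def)
  show "a \<bullet> (hess_poly f a *v a) > 0"
    using pos d by (simp add: inner_hess_poly_point[OF hom] poly_eval_dir_deriv_self[OF hom])
  assume "x \<bullet> (hess_poly f a *v a) = 0"
  then have "poly_eval (dir_deriv x f) a = 0"
    using d by (simp add: inner_hess_poly_point[OF hom])
  then show "x \<bullet> (hess_poly f a *v x) \<le> 0"
    using nsd pos unfolding hessian_ln[OF pos]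
    by (simp add: divide_le_0_iff mult_le_0_iff)
qed

lemma strictly_log_concave_at_hyperplane:
  assumes hom: "homogeneous d f" and d: "d \<ge> 2" and lc: "strictly_log_concave_at f a"
    and x: "x \<bullet> (hess_poly f a *v a) = 0" "x \<noteq> 0"
  shows "x \<bullet> (hess_poly f a *v x) < 0"
proof -
  have pos: "poly_eval f a > 0"
    and nd: "x \<bullet> (hessian (\<lambda>x. ln (poly_eval f x)) a *v x) < 0"
    using lc x by (auto simp: strictly_log_concave_at_def neg_definite_on_def)
  have "poly_eval (dir_deriv x f) a = 0"
    using x d by (simp add: inner_hess_poly_point[OF hom])
  then show ?thesis
    using nd pos unfolding hessian_ln[OF pos]
    by (simp add: divide_less_0_iff mult_less_0_iff)
qed

lemma strictly_log_concave_at_imp_log_concave_at: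
  assumes "strictly_log_concave_at f a"
  shows "log_concave_at f a" "f \<noteq> 0"
proof -
  have "x \<bullet> (hessian (\<lambda>x. ln (poly_eval f x)) a *v x) \<le> 0" for x
    using assms by (cases "x = 0") (force simp: strictly_log_concave_at_def neg_definite_on_def)+
  then show "log_concave_at f a"
    using assms by (auto simp: strictly_log_concave_at_def log_concave_at_def neg_semidefinite_on_def)
  show "f \<noteq> 0" using assms by (auto simp: strictly_log_concave_at_def)
qed

text \<open>The second partial derivatives have degree zero.\<close>

lemma hess_poly_quadratic:
  assumes "homogeneous 2 g"
  shows "hess_poly g x = hess_poly g y"
proof -
  have "homogeneous 0 (partial i (partial j g))" for i j
    using homogeneous_partial[OF homogeneous_partial[OF assms]] by simp
  then show ?thesis
    by (simp add: vec_eq_iff hess_poly_nth) (metis poly_eval_homogeneous_0_const)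
qed

text \<open>Pointedness keeps a ray that starts at a nonzero point of the cone away from the origin.\<close>

lemma proper_cone_add_scale:
  assumes K: "proper_cone K" and a: "a \<in> K - {0}" and b: "b \<in> K" and t: "t \<ge> 0"
  shows "a + t *\<^sub>R b \<in> K - {0}"
proof -
  have cone: "convex K" "cone K" and pointed: "K \<inter> uminus ` K = {0}" 
    using K by (auto simp: proper_cone_def)
  have tb: "t *\<^sub>R b \<in> K" using cone b t by (simp add: cone_def)
  then have "a + t *\<^sub>R b \<in> K" using cone a convex_cone[of K] by blast
  moreover have "a + t *\<^sub>R b \<noteq> 0"
  proof
    assume "a + t *\<^sub>R b = 0"
    then have "a = - (t *\<^sub>R b)" by (simp add: eq_neg_iff_add_eq_0)
    then have "a \<in> K \<inter> uminus ` K" using a tb by blast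
    then show False using pointed a by auto
  qed
  ultimately show ?thesis by simp
qed

text \<open>Along the ray \<open>a + t b\<close> the form \<open>g\<close> is a convex quadratic polynomial in \<open>t\<close>, since \<open>g(b) > 0\<close>.  If
  its derivative at \<open>t = 0\<close> were nonpositive, its minimum would be attained at some \<open>t \<ge> 0\<close>.  At that
  point of the cone the gradient is orthogonal to \<open>b\<close> while the second derivative is positive,
  which is incompatible with log-concavity.\<close>

lemma strict_quadratic_dir_deriv_pos:
  assumes K: "proper_cone K" and hom: "homogeneous 2 g"
    and slc: "\<And>p. p \<in> K - {0} \<Longrightarrow> strictly_log_concave_at g p"
    and a: "a \<in> K - {0}" and b: "b \<in> K - {0}"
  shows "poly_eval (dir_deriv b g) a > 0"
proof (rule ccontr)
  define G where "G = hess_poly g a"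
  have G: "hess_poly g p = G" for p unfolding G_def by (rule hess_poly_quadratic[OF hom])
  have grad: "x \<bullet> (G *v p) = poly_eval (dir_deriv x g) p" for x p
    using inner_hess_poly_point[OF hom, of x p] by (simp add: G)
  have bb: "b \<bullet> (G *v b) > 0"
    using log_concave_at_hyperplane(1)[OF hom _ strictly_log_concave_at_imp_log_concave_at[OF slc[OF b]]]
    by (simp add: G)
  assume "\<not> poly_eval (dir_deriv b g) a > 0"
  then have le: "b \<bullet> (G *v a) \<le> 0" by (simp add: grad)
  \<comment> \<open>the critical point of \<open>t \<mapsto> g(a + t b)\<close>\<close>
  define t where "t = - (b \<bullet> (G *v a)) / (b \<bullet> (G *v b))"
  have "t \<ge> 0" unfolding t_def using le bb by (simp add: divide_nonpos_pos)
  define p where "p = a + t *\<^sub>R b"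
  have p: "p \<in> K - {0}" unfolding p_def by (rule proper_cone_add_scale[OF K a]) (use b \<open>t \<ge> 0\<close> in auto)
  have "b \<bullet> (G *v p) = 0"
    using bb by (simp add: p_def matrix_vector_right_distrib matrix_vector_mult_diff_distrib
        matrix_vector_mult_scaleR inner_add_right inner_diff_right t_def)
  then have "b \<bullet> (G *v b) < 0"
    using strictly_log_concave_at_hyperplane[OF hom _ slc[OF p], of b] b by (simp add: G)
  then show False using bb by simp
qed

text \<open>The nondegenerate hypothesis controls only derivatives of degree at least two, hence the case
  distinction.  For \<open>d = 2\<close> the Hessian is constant and may be evaluated at \<open>b\<close> instead of \<open>a\<close>.  For
  \<open>d = 3\<close> the linear form \<open>D\<^sub>b D\<^sub>b f\<close> is the derivative of the strictly log-concave quadratic form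
  \<open>D\<^sub>b f\<close> in direction \<open>b\<close>.\<close>

lemma strictly_K_CLC_nondeg_hess_pos:
  assumes K: "proper_cone K" and f: "f \<noteq> 0" "homogeneous d f" "d \<ge> 2"
    and clc: "strictly_K_CLC_nondeg K f" and a: "a \<in> K - {0}" and b: "b \<in> K - {0}"
  shows "b \<bullet> (hess_poly f a *v b) > 0"
proof -
  have D: "strictly_log_concave_at (dir_derivs as f) p"
    if "set as \<subseteq> K - {0}" "length as + 2 \<le> d" "p \<in> K - {0}" for as p
    using clc that total_degree_homogeneous[OF f(2,1)] unfolding strictly_K_CLC_nondeg_def by auto
  consider "d = 2" | "d = 3" | "d \<ge> 4" using f(3) by linarith
  then show ?thesis
  proof cases
    case 1
    have "strictly_log_concave_at f b" using D[of "[]" b] 1 b by (simp add: dir_derivs_def)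
    from log_concave_at_hyperplane(1)[OF f(2,3) strictly_log_concave_at_imp_log_concave_at[OF this]]
    show ?thesis using hess_poly_quadratic[of f a b] f 1 by simp
  next
    case 2
    have "homogeneous 2 (dir_deriv b f)" using homogeneous_dir_deriv[OF f(2), of b] 2 by simp
    moreover have "strictly_log_concave_at (dir_deriv b f) p" if "p \<in> K - {0}" for p
      using D[of "[b]" p] 2 b that by (simp add: dir_derivs_def)
    ultimately show ?thesis
      unfolding inner_hess_poly by (rule strict_quadratic_dir_deriv_pos[OF K _ _ a b])
  next
    case 3
    then show ?thesis
      using D[of "[b, b]" a] a b by (simp add: dir_derivs_def inner_hess_poly strictly_log_concave_at_def)
  qed
qed

lemma K_CLC_hess_nonneg:
  assumes f: "f \<noteq> 0" "homogeneous d f" "d \<ge> 2"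
    and clc: "K_CLC K f" and a: "a \<in> interior K" and b: "b \<in> K"
  shows "b \<bullet> (hess_poly f a *v b) \<ge> 0"
proof -
  have "log_concave_at (dir_derivs [b, b] f) a"
    using clc a b f total_degree_homogeneous[OF f(2,1)] unfolding K_CLC_def by auto
  then show ?thesis by (auto simp: inner_hess_poly dir_derivs_def log_concave_at_def)
qed

lemma not_strictly_K_CLC:
  assumes K: "proper_cone K" and f: "homogeneous d f" "d \<ge> 1"
  shows "\<not> strictly_K_CLC K f"
proof
  assume "strictly_K_CLC K f"
  moreover have "0 \<in> K" using K by (auto simp: proper_cone_def)
  ultimately have "strictly_log_concave_at (dir_derivs [] f) 0"
    unfolding strictly_K_CLC_def by (metis empty_set empty_subsetI list.size(3) zero_le)
  then show False
    using poly_eval_homogeneous_origin[OF f] by (simp add: dir_derivs_def strictly_log_concave_at_def)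
qed

theorem theorem3p6:
  fixes K :: "(real ^ 'n::finite) set" and f :: "'n mpoly" and d :: nat
  assumes "proper_cone K" and "f \<noteq> 0" and "homogeneous d f" and "d \<ge> 2"
  shows
    "(strictly_K_CLC K f \<longrightarrow>
        (\<forall>a\<in>K. invertible (hess_poly f a) \<and> num_pos_eigenvalues (hess_poly f a) = 1) \<and>
        (\<forall>a\<in>K. \<forall>b\<in>K. hess_poly f a *v b \<noteq> 0 \<longrightarrow>
            neg_definite_on ({hess_poly f a *v b}\<^sup>\<bottom>) (hess_poly f a)))
     \<and> (strictly_K_CLC_nondeg K f \<longrightarrow>
        (\<forall>a\<in>K - {0}. invertible (hess_poly f a) \<and> num_pos_eigenvalues (hess_poly f a) = 1) \<and>
        (\<forall>a\<in>K - {0}. \<forall>b\<in>K. hess_poly f a *v b \<noteq> 0 \<longrightarrow>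
            neg_definite_on ({hess_poly f a *v b}\<^sup>\<bottom>) (hess_poly f a)))
     \<and> (K_CLC K f \<longrightarrow>
        (\<forall>a\<in>interior K. num_pos_eigenvalues (hess_poly f a) = 1) \<and>
        (\<forall>a\<in>interior K. \<forall>b\<in>K. hess_poly f a *v b \<noteq> 0 \<longrightarrow>
            neg_semidefinite_on ({hess_poly f a *v b}\<^sup>\<bottom>) (hess_poly f a)))"
proof (intro conjI impI)
  note f = assms(2-4)
  note sym = transpose_hess_poly[of f]
  have deg: "total_degree f = d" by (rule total_degree_homogeneous[OF f(2,1)])
  {
    assume "strictly_K_CLC K f"
    then have False using not_strictly_K_CLC[OF assms(1) f(2)] f(3) by simp
  }
  then show "strictly_K_CLC K f \<Longrightarrow>
      \<forall>a\<in>K. invertible (hess_poly f a) \<and> num_pos_eigenvalues (hess_poly f a) = 1"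
    and "strictly_K_CLC K f \<Longrightarrow> \<forall>a\<in>K. \<forall>b\<in>K. hess_poly f a *v b \<noteq> 0 \<longrightarrow>
            neg_definite_on ({hess_poly f a *v b}\<^sup>\<bottom>) (hess_poly f a)" by blast+
  {
    assume clc: "strictly_K_CLC_nondeg K f"
    have slc: "strictly_log_concave_at f a" if "a \<in> K - {0}" for a
      using clc that f(3) deg unfolding strictly_K_CLC_nondeg_def
      by (auto dest!: spec[of _ "[]"] simp: dir_derivs_def)
    note lc = strictly_log_concave_at_imp_log_concave_at[OF slc]
    note nd = strictly_log_concave_at_hyperplane[OF f(2,3) slc]
    show "\<forall>a\<in>K - {0}. invertible (hess_poly f a) \<and> num_pos_eigenvalues (hess_poly f a) = 1"
    proof (intro ballI conjI)
      fix a assume a: "a \<in> K - {0}"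
      show "invertible (hess_poly f a)"
        by (rule invertible_neg_definite_hyperplane[OF sym nd[OF a]])
      show "num_pos_eigenvalues (hess_poly f a) = 1"
        by (rule num_pos_eigenvalues_hyperplane[OF sym log_concave_at_hyperplane[OF f(2,3) lc(1)[OF a] lc(2)[OF a]]])
    qed
    show "\<forall>a\<in>K - {0}. \<forall>b\<in>K. hess_poly f a *v b \<noteq> 0 \<longrightarrow>
            neg_definite_on ({hess_poly f a *v b}\<^sup>\<bottom>) (hess_poly f a)"
    proof (intro ballI impI)
      fix a b assume a: "a \<in> K - {0}" and "b \<in> K" and "hess_poly f a *v b \<noteq> 0"
      then have "b \<in> K - {0}" by auto
      then show "neg_definite_on ({hess_poly f a *v b}\<^sup>\<bottom>) (hess_poly f a)"
        using strictly_K_CLC_nondeg_hess_pos[OF assms clc a]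
        by (intro neg_definite_on_conjugate[OF sym nd[OF a]]) auto
    qed
  }
  {
    assume clc: "K_CLC K f"
    have lc: "log_concave_at f a" if "a \<in> interior K" for a
      using clc that unfolding K_CLC_def
      by (auto dest!: spec[of _ "[]"] simp: dir_derivs_def)
    note nsd = log_concave_at_hyperplane[OF f(2,3) lc f(1)]
    show "\<forall>a\<in>interior K. num_pos_eigenvalues (hess_poly f a) = 1"
      by (intro ballI num_pos_eigenvalues_hyperplane[OF sym nsd])
    show "\<forall>a\<in>interior K. \<forall>b\<in>K. hess_poly f a *v b \<noteq> 0 \<longrightarrow>
            neg_semidefinite_on ({hess_poly f a *v b}\<^sup>\<bottom>) (hess_poly f a)"
      by (intro ballI impI neg_semidefinite_on_conjugate[OF sym nsd K_CLC_hess_nonneg[OF f clc]])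
  }
qed

end
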